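(* Let $p\ge 5$ be a prime, let $H\le G=\mathrm{SL}(2,p)$ and let $x\in G$ be such that $S=H\cup\{x,x^{-1}\}$ satisfies $\langle S\rangle=G$. Then either $HxH$ and $Hx^{-1}H$ are disjoint, or there exists $y\in Hx$ with $y^2\in H$ such that $T=H\cup\{y,y^{-1}\}$ satisfies $\langle T\rangle=G$, $|T|=|S|$ and $T^3\subseteq S^3$.
   Context: For a subset $S$ of a group, $S^3=\{abc: a,b,c\in S\}$. $HxH=\{hxk: h,k\in H\}$ denotes the double coset. *)

theory Defs
  imports
    "HOL-Analysis.Determinants"
    "HOL-Algebra.Generated_Groups"
    "HOL-Computational_Algebra.Primes"
begin

text \<open>\<open>SL2\<close> depends on its field through the type only: for a field \<open>'a\<close> with
  \<open>CARD('a) = p\<close>, \<open>p\<close> prime, \<open>SL2 :: ('a ^ 2 ^ 2) monoid\<close> is \<open>SL(2,p)\<close>.\<close>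

definition SL2 :: "('a::field ^ 2 ^ 2) monoid" where
  "SL2 = \<lparr>carrier = {A. det A = 1}, monoid.mult = (**), one = mat 1\<rparr>"

lemma group_SL2: "group (SL2 :: ('a::field ^ 2 ^ 2) monoid)"
proof (rule groupI)
  fix A :: "'a ^ 2 ^ 2"
  assume "A \<in> carrier SL2"
  then have A: "det A = 1" by (simp add: SL2_def)
  then have "invertible A" by (simp add: invertible_det_nz)
  then obtain B where B: "B ** A = mat 1" by (auto simp: invertible_def)
  have "det B * det A = 1"
    using B by (metis det_I det_mul)
  with A B show "\<exists>B\<in>carrier SL2. B \<otimes>\<^bsub>SL2\<^esub> A = \<one>\<^bsub>SL2\<^esub>"
    by (auto simp: SL2_def)
qed (auto simp: SL2_def det_mul matrix_mul_assoc)

definition double_coset :: "('g, 'm) monoid_scheme \<Rightarrow> 'g set \<Rightarrow> 'g \<Rightarrow> 'g set" where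
  "double_coset G H x = {h \<otimes>\<^bsub>G\<^esub> x \<otimes>\<^bsub>G\<^esub> k | h k. h \<in> H \<and> k \<in> H}"

definition set_cube :: "('g, 'm) monoid_scheme \<Rightarrow> 'g set \<Rightarrow> 'g set" where
  "set_cube G S = {a \<otimes>\<^bsub>G\<^esub> b \<otimes>\<^bsub>G\<^esub> c | a b c. a \<in> S \<and> b \<in> S \<and> c \<in> S}"

end

theory Submission
  imports Defs "HOL-Number_Theory.Residues"
begin

text \<open>If \<open>HxH\<close> and \<open>Hx\<^sup>-\<^sup>1H\<close> meet, then \<open>x\<^sup>-\<^sup>1 = hxk\<close> with \<open>h, k \<in> H\<close>, and \<open>y = hx\<close> is the
  element sought (unless \<open>x \<in> H\<close>, where \<open>y = x\<close> will do). Indeed \<open>xhxk = 1\<close> gives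
  \<open>y\<^sup>2 = hk\<^sup>-\<^sup>1 \<in> H\<close>, and \<open>\<langle>H, y\<rangle> = \<langle>H, x\<rangle>\<close> because \<open>y \<in> Hx\<close>.

  As \<open>y\<^sup>2 \<in> H\<close>, the inverse of \<open>y\<close> lies in \<open>Hy\<close> and in \<open>yH\<close>, so that every product of three
  elements of \<open>T\<close> lies in \<open>H\<close>, in \<open>HyH\<close> or in \<open>yHy\<close> (\<open>set_cube_subset_if_square_mem\<close>). The
  first two sets lie in \<open>S\<^sup>3\<close> because \<open>HyH = HxH\<close>. The third does because \<open>y\<close> can be written in
  two ways, \<open>y = hx = x\<^sup>-\<^sup>1k\<^sup>-\<^sup>1\<close>, whence \<open>yHy = x\<^sup>-\<^sup>1Hx\<close> (\<open>set_cube_subset_of_inv_eq\<close>).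

  All this holds in any group. Only \<open>|T| = |S|\<close> depends on the group: it could fail if exactly one of
  \<open>x\<close> and \<open>y\<close> were an involution outside \<open>H\<close>. In \<open>SL(2,p)\<close> with \<open>p\<close> odd, \<open>z\<^sup>2 = 1\<close> forces
  \<open>z = \<plusminus>1\<close>, which is central. If \<open>H\<close> and a central \<open>z\<close> with \<open>z\<^sup>2 = 1\<close> generate the group, then
  \<open>G = H \<union> zH\<close> and all squares lie in \<open>H\<close>; but \<open>-1\<close> is a square, so \<open>z \<in> H\<close>
  (\<open>SL2_involution_mem_if_generates\<close>). Hence neither \<open>x\<close> nor \<open>y\<close> is an involution outside \<open>H\<close>.\<close>

section \<open>Double cosets and products of three elements\<close>

lemma (in group) double_cosets_meet_imp_inv_eq:
  assumes H: "subgroup H G" and x: "x \<in> carrier G"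
    and meet: "double_coset G H x \<inter> double_coset G H (inv x) \<noteq> {}"
  shows "\<exists>h\<in>H. \<exists>k\<in>H. inv x = h \<otimes> x \<otimes> k"
proof -
  interpret H: subgroup H G by (rule H)
  from meet obtain a b c d where abcd: "a \<in> H" "b \<in> H" "c \<in> H" "d \<in> H"
    and eq: "a \<otimes> x \<otimes> b = c \<otimes> inv x \<otimes> d"
    unfolding double_coset_def by blast
  have C: "a \<in> carrier G" "b \<in> carrier G" "c \<in> carrier G" "d \<in> carrier G"
    using abcd by auto
  have "inv x = inv c \<otimes> (c \<otimes> inv x \<otimes> d) \<otimes> inv d"
    using C x by (simp add: m_assoc inv_solve_left)
  also have "\<dots> = inv c \<otimes> (a \<otimes> x \<otimes> b) \<otimes> inv d"
    by (simp add: eq)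
  also have "\<dots> = (inv c \<otimes> a) \<otimes> x \<otimes> (b \<otimes> inv d)"
    using C x by (simp add: m_assoc)
  finally show ?thesis
    using abcd by (intro bexI[of _ "inv c \<otimes> a"] bexI[of _ "b \<otimes> inv d"]) auto
qed

text \<open>Since \<open>y\<^sup>2 \<in> H\<close>, a product of three factors collapses according to where its factors
  \<open>y\<^sup>\<plusminus>\<^sup>1\<close> stand: two adjacent ones cancel into \<open>H\<close>, so that only \<open>H\<close>, \<open>HyH\<close> and \<open>yHy\<close>
  can arise.\<close>

lemma (in group) set_cube_subset_if_square_mem:
  assumes H: "subgroup H G" and y: "y \<in> carrier G" and sq: "y \<otimes> y \<in> H"
    and HW: "H \<subseteq> W"
    and HyHW: "\<And>g k. g \<in> H \<Longrightarrow> k \<in> H \<Longrightarrow> g \<otimes> y \<otimes> k \<in> W"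
    and yHyW: "\<And>g. g \<in> H \<Longrightarrow> y \<otimes> g \<otimes> y \<in> W"
  shows "set_cube G (H \<union> {y, inv y}) \<subseteq> W"
proof -
  interpret H: subgroup H G by (rule H)
  define Y where "Y = {t. \<exists>u\<in>H. t = y \<otimes> u \<and> t = u \<otimes> y}"
  \<comment> \<open>Both members of the pair \<open>y, y\<^sup>-\<^sup>1\<close> have the form \<open>yu = uy\<close>, with \<open>u = 1\<close> and
     \<open>u = y\<^sup>-\<^sup>2\<close>; the factor \<open>y\<close> can thus be moved to whichever side a product requires.\<close>
  have "y \<in> Y"
    unfolding Y_def using y by (auto intro: bexI[of _ "\<one>"])
  moreover have "inv y \<in> Y"
  proof -
    have "inv y = y \<otimes> inv (y \<otimes> y)"
      using y by (simp add: inv_mult_group flip: m_assoc)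
    moreover have "inv y = inv (y \<otimes> y) \<otimes> y"
      using y by (simp add: inv_mult_group m_assoc)
    ultimately show ?thesis
      unfolding Y_def using sq by blast
  qed
  ultimately have T: "t \<in> H \<or> t \<in> Y" if "t \<in> H \<union> {y, inv y}" for t
    using that by blast
  have Hy: "g \<otimes> y \<in> W" if "g \<in> H" for g
    using HyHW[OF that H.one_closed] that y by simp
  have yH: "y \<otimes> g \<in> W" if "g \<in> H" for g
    using HyHW[OF H.one_closed that] that y by simp
  have "a \<otimes> b \<otimes> c \<in> W"
    if abc: "a \<in> H \<union> {y, inv y}" "b \<in> H \<union> {y, inv y}" "c \<in> H \<union> {y, inv y}" for a b c
  proof -
    consider (HHH) "a \<in> H" "b \<in> H" "c \<in> H" | (HHY) "a \<in> H" "b \<in> H" "c \<in> Y"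
      | (HYH) "a \<in> H" "b \<in> Y" "c \<in> H" | (YHH) "a \<in> Y" "b \<in> H" "c \<in> H"
      | (HYY) "a \<in> H" "b \<in> Y" "c \<in> Y" | (YHY) "a \<in> Y" "b \<in> H" "c \<in> Y"
      | (YYH) "a \<in> Y" "b \<in> Y" "c \<in> H" | (YYY) "a \<in> Y" "b \<in> Y" "c \<in> Y"
      using abc[THEN T] by blast
    then show ?thesis
    proof cases
      case HHH
      then show ?thesis using HW by blast
    next
      case HHY
      then obtain w where w: "w \<in> H" "c = w \<otimes> y" unfolding Y_def by blast
      then have "a \<otimes> b \<otimes> c = (a \<otimes> b \<otimes> w) \<otimes> y" using HHY y by (simp add: m_assoc)
      then show ?thesis using Hy[of "a \<otimes> b \<otimes> w"] HHY w by simp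
    next
      case HYH
      then obtain v where v: "v \<in> H" "b = y \<otimes> v" unfolding Y_def by blast
      then have "a \<otimes> b \<otimes> c = a \<otimes> y \<otimes> (v \<otimes> c)" using HYH y by (simp add: m_assoc)
      then show ?thesis using HyHW[of a "v \<otimes> c"] HYH v by simp
    next
      case YHH
      then obtain u where u: "u \<in> H" "a = y \<otimes> u" unfolding Y_def by blast
      then have "a \<otimes> b \<otimes> c = y \<otimes> (u \<otimes> b \<otimes> c)" using YHH y by (simp add: m_assoc)
      then show ?thesis using yH[of "u \<otimes> b \<otimes> c"] YHH u by simp
    next
      case HYY
      then obtain v w where vw: "v \<in> H" "b = v \<otimes> y" "w \<in> H" "c = y \<otimes> w"
        unfolding Y_def by blast
      then have "a \<otimes> b \<otimes> c = a \<otimes> v \<otimes> (y \<otimes> y) \<otimes> w" using HYY y by (simp add: m_assoc)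
      then show ?thesis using subsetD[OF HW, of "a \<otimes> v \<otimes> (y \<otimes> y) \<otimes> w"] HYY vw sq by simp
    next
      case YHY
      then obtain u w where uw: "u \<in> H" "a = y \<otimes> u" "w \<in> H" "c = w \<otimes> y"
        unfolding Y_def by blast
      then have "a \<otimes> b \<otimes> c = y \<otimes> (u \<otimes> b \<otimes> w) \<otimes> y" using YHY y by (simp add: m_assoc)
      then show ?thesis using yHyW[of "u \<otimes> b \<otimes> w"] YHY uw by simp
    next
      case YYH
      then obtain u v where uv: "u \<in> H" "a = u \<otimes> y" "v \<in> H" "b = y \<otimes> v"
        unfolding Y_def by blast
      then have "a \<otimes> b \<otimes> c = u \<otimes> (y \<otimes> y) \<otimes> v \<otimes> c" using YYH y by (simp add: m_assoc)
      then show ?thesis using subsetD[OF HW, of "u \<otimes> (y \<otimes> y) \<otimes> v \<otimes> c"] YYH uv sq by simp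
    next
      case YYY
      then obtain u v w where uvw: "u \<in> H" "a = u \<otimes> y" "v \<in> H" "b = y \<otimes> v"
        "w \<in> H" "c = w \<otimes> y"
        unfolding Y_def by blast
      then have "a \<otimes> b \<otimes> c = (u \<otimes> (y \<otimes> y) \<otimes> v \<otimes> w) \<otimes> y" using y by (simp add: m_assoc)
      then show ?thesis using Hy[of "u \<otimes> (y \<otimes> y) \<otimes> v \<otimes> w"] uvw sq by simp
    qed
  qed
  then show ?thesis unfolding set_cube_def by blast
qed

lemma (in group) square_mem_of_inv_eq:
  assumes H: "subgroup H G" and x: "x \<in> carrier G" and hk: "h \<in> H" "k \<in> H"
    and inv_x: "inv x = h \<otimes> x \<otimes> k"
  shows "(h \<otimes> x) \<otimes> (h \<otimes> x) \<in> H"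
proof -
  interpret H: subgroup H G by (rule H)
  have C: "h \<in> carrier G" "k \<in> carrier G" using hk by auto
  have "h \<otimes> x = inv x \<otimes> inv k"
    using C x by (simp add: inv_x m_assoc)
  then have "(h \<otimes> x) \<otimes> (h \<otimes> x) = h \<otimes> inv k"
    using C x by (metis inv_closed m_assoc m_closed r_inv r_one)
  then show ?thesis using hk by simp
qed

text \<open>Left factors \<open>hx\<close> are rewritten as \<open>x\<^sup>-\<^sup>1k\<^sup>-\<^sup>1\<close> and right factors are kept: this brings
  \<open>(hx)g(hx)\<close> into \<open>x\<^sup>-\<^sup>1Hx\<close>, whereas \<open>hxHx\<close> itself is not visibly a set of products of three
  elements of \<open>H \<union> {x, x\<^sup>-\<^sup>1}\<close>.\<close>

lemma (in group) set_cube_subset_of_inv_eq: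
  assumes H: "subgroup H G" and x: "x \<in> carrier G" and hk: "h \<in> H" "k \<in> H"
    and inv_x: "inv x = h \<otimes> x \<otimes> k"
  shows "set_cube G (H \<union> {h \<otimes> x, inv (h \<otimes> x)}) \<subseteq> set_cube G (H \<union> {x, inv x})"
proof -
  interpret H: subgroup H G by (rule H)
  have C: "h \<in> carrier G" "k \<in> carrier G" using hk by auto
  let ?S = "H \<union> {x, inv x}"
  have cubeI: "t \<in> set_cube G ?S" if "a \<in> ?S" "b \<in> ?S" "c \<in> ?S" "t = a \<otimes> b \<otimes> c" for a b c t
    using that unfolding set_cube_def by blast
  show ?thesis
  proof (rule set_cube_subset_if_square_mem[OF H])
    show "h \<otimes> x \<in> carrier G" using C x by simp
    show "(h \<otimes> x) \<otimes> (h \<otimes> x) \<in> H" by (rule square_mem_of_inv_eq[OF H x hk inv_x])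
    show "H \<subseteq> set_cube G ?S"
    proof
      fix g assume "g \<in> H"
      then show "g \<in> set_cube G ?S" by (intro cubeI[of g \<one> \<one>]) auto
    qed
    show "g \<otimes> (h \<otimes> x) \<otimes> k' \<in> set_cube G ?S" if "g \<in> H" "k' \<in> H" for g k'
      using that hk C x by (intro cubeI[of "g \<otimes> h" x k']) (auto simp: m_assoc)
    show "(h \<otimes> x) \<otimes> g \<otimes> (h \<otimes> x) \<in> set_cube G ?S" if "g \<in> H" for g
    proof (rule cubeI[of "inv x" "inv k \<otimes> g \<otimes> h" x])
      have "h \<otimes> x = inv x \<otimes> inv k"
        using C x by (simp add: inv_x m_assoc)
      then have "(h \<otimes> x) \<otimes> g \<otimes> (h \<otimes> x) = (inv x \<otimes> inv k) \<otimes> g \<otimes> (h \<otimes> x)" by simp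
      also have "\<dots> = inv x \<otimes> (inv k \<otimes> g \<otimes> h) \<otimes> x"
        using C x that by (simp add: m_assoc)
      finally show "(h \<otimes> x) \<otimes> g \<otimes> (h \<otimes> x) = inv x \<otimes> (inv k \<otimes> g \<otimes> h) \<otimes> x" .
    qed (use that hk in auto)
  qed
qed

lemma (in group) generate_replace_by_coset_rep:
  assumes H: "subgroup H G" and x: "x \<in> carrier G" and h: "h \<in> H"
    and gen: "generate G (H \<union> {x, inv x}) = carrier G"
  shows "generate G (H \<union> {h \<otimes> x, inv (h \<otimes> x)}) = carrier G"
proof -
  interpret H: subgroup H G by (rule H)
  let ?T = "H \<union> {h \<otimes> x, inv (h \<otimes> x)}"
  have T: "?T \<subseteq> carrier G" using h x by auto
  have sub: "subgroup (generate G ?T) G" by (rule generate_is_subgroup[OF T])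
  have "inv h \<otimes> (h \<otimes> x) \<in> generate G ?T"
    using h by (intro generate.eng generate.incl) auto
  moreover have "inv h \<otimes> (h \<otimes> x) = x"
    using h x by (simp add: m_assoc[symmetric])
  ultimately have "x \<in> generate G ?T" by simp
  then have "H \<union> {x, inv x} \<subseteq> generate G ?T"
    using subgroup.m_inv_closed[OF sub] by (auto intro: generate.incl)
  from generate_subgroup_incl[OF this sub] show ?thesis
    using gen generate_incl[OF T] by blast
qed

text \<open>The value for infinite \<open>H\<close> is the convention for \<open>card\<close>. Both cases depend on \<open>H\<close> alone,
  so any two such extensions of \<open>H\<close> have equal cardinality.\<close>

lemma (in group) card_insert_inverse_pair:
  assumes H: "subgroup H G" and x: "x \<in> carrier G" "x \<notin> H"
    and not_inv: "x \<otimes> x \<noteq> \<one>"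
  shows "card (H \<union> {x, inv x}) = (if finite H then card H + 2 else 0)"
proof -
  have "inv x \<notin> H"
    using x subgroup.m_inv_closed[OF H, of "inv x"] by auto
  moreover have "x \<noteq> inv x"
    using x not_inv r_inv by metis
  ultimately show ?thesis
    using x by simp
qed

section \<open>Involutions of the special linear group\<close>

text \<open>The set \<open>H \<union> zH\<close> is closed under products and inverses, hence is the whole group, and
  \<open>(za)\<^sup>2 = a\<^sup>2\<close>.\<close>

lemma (in group) square_mem_if_central_involution_generates:
  assumes H: "subgroup H G" and z: "z \<in> carrier G" "z \<otimes> z = \<one>"
    and central: "\<And>g. g \<in> carrier G \<Longrightarrow> z \<otimes> g = g \<otimes> z"
    and gen: "generate G (H \<union> {z, inv z}) = carrier G"
    and g: "g \<in> carrier G"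
  shows "g \<otimes> g \<in> H"
proof -
  interpret H: subgroup H G by (rule H)
  have inv_z: "inv z = z" using z by (simp add: inv_equality)
  have zz: "z \<otimes> (z \<otimes> a) = a" if "a \<in> carrier G" for a
    using z that by (simp add: m_assoc[symmetric])
  have swap: "a \<otimes> (z \<otimes> b) = z \<otimes> (a \<otimes> b)" if "a \<in> carrier G" "b \<in> carrier G" for a b
    using z(1) that by (metis central m_assoc)
  have coset: "\<exists>a\<in>H. g = a \<or> g = z \<otimes> a" if "g \<in> generate G (H \<union> {z, inv z})" for g
    using that
  proof induction
    case one
    show ?case using H.one_closed by blast
  next
    case (incl g)
    then have "g \<in> H \<or> g = z \<otimes> \<one>" using z inv_z by auto
    then show ?case using H.one_closed by blast
  next
    case (inv g)
    then have "inv g \<in> H \<or> inv g = z \<otimes> \<one>" using z inv_z by auto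
    then show ?case using H.one_closed by blast
  next
    case (eng g g')
    then obtain a b where ab: "a \<in> H" "b \<in> H" "g = a \<or> g = z \<otimes> a" "g' = b \<or> g' = z \<otimes> b"
      by blast
    have "g \<otimes> g' = a \<otimes> b \<or> g \<otimes> g' = z \<otimes> (a \<otimes> b)"
      using ab z by (auto simp: m_assoc swap[of a b] zz)
    then show ?case using ab by blast
  qed
  obtain a where a: "a \<in> H" "g = a \<or> g = z \<otimes> a"
    using coset g gen by blast
  then show ?thesis
    using z by (auto simp: m_assoc swap[of a a] zz)
qed

lemma SL2_simps [simp]:
  "A \<in> carrier SL2 \<longleftrightarrow> det A = 1" "A \<otimes>\<^bsub>SL2\<^esub> B = A ** B" "\<one>\<^bsub>SL2\<^esub> = mat 1"
  by (simp_all add: SL2_def)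

text \<open>For \<open>z\<close> with rows \<open>(a, b)\<close>, \<open>(c, d)\<close>, the off-diagonal entries of \<open>z\<^sup>2\<close> are
  \<open>b(a + d)\<close> and \<open>c(a + d)\<close>. The trace cannot vanish: with \<open>d = -a\<close>, the upper left entry
  \<open>a\<^sup>2 + bc\<close> of \<open>z\<^sup>2\<close> would be \<open>-det z = -1\<close> instead of \<open>1\<close>. So \<open>z\<close> is diagonal.\<close>

lemma SL2_involution_cases:
  fixes z :: "'a::field ^ 2 ^ 2"
  assumes two: "(2::'a) \<noteq> 0" and det: "det z = 1" and sq: "z ** z = mat 1"
  shows "z = mat 1 \<or> z = - mat 1"
proof -
  define a b c d where "a = z$1$1" "b = z$1$2" "c = z$2$1" "d = z$2$2"
  note abcd = this
  have D: "a * d - b * c = 1" using det by (simp add: det_2 abcd)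
  have sq_entry: "(\<Sum>k\<in>UNIV. z$i$k * z$k$j) = (if i = j then 1 else 0)" for i j
    using sq by (simp add: vec_eq_iff matrix_matrix_mult_def mat_def)
  have E: "a * a + b * c = 1" "a * b + b * d = 0" "c * a + d * c = 0" "c * b + d * d = 1"
    using sq_entry[of 1 1] sq_entry[of 1 2] sq_entry[of 2 1] sq_entry[of 2 2]
    by (simp_all add: sum_2 abcd)
  have tr: "a + d \<noteq> 0"
  proof
    assume "a + d = 0"
    then have "d = - a" by (simp add: eq_neg_iff_add_eq_0 add.commute)
    then have "(a * d - b * c) + (a * a + b * c) = 0" by simp
    then have "(2::'a) = 0" unfolding D E(1) by simp
    then show False using two by simp
  qed
  have "b * (a + d) = 0" "c * (a + d) = 0" using E by (simp_all add: algebra_simps)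
  then have bc: "b = 0" "c = 0" using tr by auto
  then have "a * a = 1" "a * d = 1" using E D by auto
  then have "a * d = a * a" and "a \<noteq> 0" by auto
  then have "d = a" by simp
  have "a = 1 \<or> a = - 1" using \<open>a * a = 1\<close> by (simp add: square_eq_1_iff)
  then show ?thesis
    using bc \<open>d = a\<close> by (auto simp: vec_eq_iff forall_2 mat_def abcd)
qed

text \<open>Adjoining \<open>-1\<close> to a proper subgroup never yields all of \<open>SL(2,F)\<close>: otherwise every square
  would lie in the subgroup, and \<open>-1\<close> is a square.\<close>

lemma SL2_involution_mem_if_generates:
  fixes z :: "'a::field ^ 2 ^ 2"
  assumes two: "(2::'a) \<noteq> 0" and H: "subgroup H SL2"
    and z: "z \<in> carrier SL2" "z \<otimes>\<^bsub>SL2\<^esub> z = \<one>\<^bsub>SL2\<^esub>"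
    and gen: "generate SL2 (H \<union> {z, inv\<^bsub>SL2\<^esub> z}) = carrier SL2"
  shows "z \<in> H"
proof -
  interpret group "SL2 :: ('a ^ 2 ^ 2) monoid" by (rule group_SL2)
  \<comment> \<open>\<open>w\<close> is a quarter turn, a square root of \<open>-1\<close>.\<close>
  define w :: "'a ^ 2 ^ 2" where "w = vector [vector [0, 1], vector [- 1, 0]]"
  have w: "w \<in> carrier SL2" by (simp add: w_def det_2)
  have ww: "w ** w = - mat 1"
    by (simp add: w_def vec_eq_iff forall_2 matrix_matrix_mult_def sum_2 mat_def)
  from SL2_involution_cases[OF two] z have cases: "z = mat 1 \<or> z = - mat 1" by simp
  then have central: "z \<otimes>\<^bsub>SL2\<^esub> g = g \<otimes>\<^bsub>SL2\<^esub> z" for g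
    by (auto simp: vec_eq_iff forall_2 matrix_matrix_mult_def sum_2 mat_def)
  have "w \<otimes>\<^bsub>SL2\<^esub> w \<in> H"
    by (rule square_mem_if_central_involution_generates[OF H z central gen w])
  then show ?thesis
    using cases ww subgroup.one_closed[OF H] by auto
qed

lemma two_neq_zero_if_card_odd_prime:
  assumes "prime CARD('a::field)" and "CARD('a) \<noteq> 2"
  shows "(2::'a) \<noteq> 0"
proof
  assume "(2::'a) = 0"
  then have "CHAR('a) dvd 2"
    using of_nat_eq_0_iff_char_dvd[where ?'a = 'a, of 2] by simp
  moreover from this have "CHAR('a) \<le> 2"
    by (rule dvd_imp_le) simp
  moreover have "CHAR('a) \<noteq> 0"
    using \<open>CHAR('a) dvd 2\<close> dvd_0_left zero_neq_numeral by metis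
  ultimately have "CHAR('a) = 2"
    using CHAR_not_1[where ?'a = 'a] by linarith
  then have "2 dvd CARD('a)"
    using CHAR_dvd_CARD[where ?'a = 'a] by simp
  then show False
    using primes_dvd_imp_eq[OF two_is_prime_nat assms(1)] assms(2) by simp
qed

section \<open>Replacing the generator by one whose square lies in the subgroup\<close>

theorem theorem3p1:
  fixes p :: nat
    and G :: "('a::field ^ 2 ^ 2) monoid"
    and H S :: "('a ^ 2 ^ 2) set"
    and x :: "'a ^ 2 ^ 2"
  assumes "prime p" and "p \<ge> 5" and "CARD('a) = p"
    and "G = SL2"
    and "subgroup H G"
    and "x \<in> carrier G"
    and "S = H \<union> {x, inv\<^bsub>G\<^esub> x}"
    and "generate G S = carrier G"
  shows "double_coset G H x \<inter> double_coset G H (inv\<^bsub>G\<^esub> x) = {} \<or>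
    (\<exists>y \<in> H #>\<^bsub>G\<^esub> x. \<exists>T.
       y [^]\<^bsub>G\<^esub> (2::nat) \<in> H \<and>
       T = H \<union> {y, inv\<^bsub>G\<^esub> y} \<and>
       generate G T = carrier G \<and>
       card T = card S \<and>
       set_cube G T \<subseteq> set_cube G S)"
proof (cases "double_coset G H x \<inter> double_coset G H (inv\<^bsub>G\<^esub> x) = {} \<or> x \<in> H")
  case True
  \<comment> \<open>If \<open>x \<in> H\<close>, then \<open>y = x\<close> and \<open>T = S\<close> satisfy all conditions.\<close>
  interpret group G using assms(4) group_SL2 by simp
  show ?thesis
  proof (cases "x \<in> H")
    case x: True
    have "x [^]\<^bsub>G\<^esub> (2::nat) \<in> H"
      using x assms(6) subgroup.m_closed[OF assms(5)] by (simp add: numeral_2_eq_2)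
    then show ?thesis
      using rcos_self[OF assms(6,5)] assms(7,8) by blast
  qed (use True in blast)
next
  case False
  interpret group G using assms(4) group_SL2 by simp
  note H = \<open>subgroup H G\<close> and x = \<open>x \<in> carrier G\<close>
  interpret H: subgroup H G by (rule H)
  have two: "(2::'a) \<noteq> 0"
    using assms(1-3) by (intro two_neq_zero_if_card_odd_prime) auto
  from double_cosets_meet_imp_inv_eq[OF H x] False
  obtain h k where hk: "h \<in> H" "k \<in> H" and inv_x: "inv\<^bsub>G\<^esub> x = h \<otimes>\<^bsub>G\<^esub> x \<otimes>\<^bsub>G\<^esub> k"
    by blast
  define y where "y = h \<otimes>\<^bsub>G\<^esub> x"
  have y: "y \<in> carrier G" using hk x by (simp add: y_def)
  have y_coset: "y \<in> H #>\<^bsub>G\<^esub> x" unfolding y_def r_coset_def using hk by blast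
  have yH: "y \<notin> H"
  proof
    assume "y \<in> H"
    then have "inv\<^bsub>G\<^esub> h \<otimes>\<^bsub>G\<^esub> y \<in> H" using hk by simp
    then show False using False hk x by (simp add: y_def m_assoc[symmetric])
  qed
  have sq: "y [^]\<^bsub>G\<^esub> (2::nat) \<in> H"
    using square_mem_of_inv_eq[OF H x hk inv_x] y by (simp add: numeral_2_eq_2 y_def)
  have genS: "generate G (H \<union> {x, inv\<^bsub>G\<^esub> x}) = carrier G" using assms(7,8) by simp
  have genT: "generate G (H \<union> {y, inv\<^bsub>G\<^esub> y}) = carrier G"
    unfolding y_def by (rule generate_replace_by_coset_rep[OF H x hk(1) genS])
  have no_involution: "t \<otimes>\<^bsub>G\<^esub> t \<noteq> \<one>\<^bsub>G\<^esub>"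
    if "t \<in> carrier G" "t \<notin> H" "generate G (H \<union> {t, inv\<^bsub>G\<^esub> t}) = carrier G" for t
    using SL2_involution_mem_if_generates[OF two, of H t] H that
    unfolding \<open>G = SL2\<close> by blast
  have "card (H \<union> {y, inv\<^bsub>G\<^esub> y}) = card S"
    using card_insert_inverse_pair[OF H y yH no_involution[OF y yH genT]]
      card_insert_inverse_pair[OF H x _ no_involution[OF x _ genS]] False
    by (simp add: assms(7))
  moreover have "set_cube G (H \<union> {y, inv\<^bsub>G\<^esub> y}) \<subseteq> set_cube G S"
    unfolding y_def assms(7) by (rule set_cube_subset_of_inv_eq[OF H x hk inv_x])
  ultimately show ?thesis using y_coset sq genT by blast
qed

end
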